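(* Let the integers $M(n)$ and $T^\ast(n)$, $n\ge 0$, be defined by \[ \sum_{n\geq 0}M(n)q^n=\frac{f_2^5f_5^5}{f_1f_{10}},\qquad \sum_{n\geq 0}T^\ast(n)q^n=\frac{f_1^5f_{10}^5}{f_2f_5}. \] Then \[ \sum_{n\geq 0}T^{\ast}(5n+3)q^n=5\sum_{n\geq 0}M(n)q^n. \]
   Context: For a positive integer $k$, $f_k:=(q^k;q^k)_\infty=\prod_{i\geq 1}(1-q^{ki})$, regarded as a formal power series in $q$ with integer coefficients (invertible, since its constant term is $1$). The identities are identities of formal power series in $q$. *)

theory Defs
  imports
    "HOL-Computational_Algebra.Formal_Power_Series"
    "HOL-Analysis.Infinite_Products"
begin

text \<open>
  The infinite product is the limit of the partial products in the usual (coefficientwise)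
  topology on formal power series; \<open>eta_fps_has_prod\<close> below shows that it converges
  for positive \<open>k\<close>. The product in \<open>prodinf\<close> starts at index 0, hence the \<open>Suc\<close>.
\<close>
definition eta_fps :: "nat \<Rightarrow> int fps" where
  "eta_fps k = (\<Prod>i. 1 - fps_X ^ (k * Suc i))"

text \<open>
  The type \<open>int fps\<close> has no \<open>inverse\<close> operation in the library. However,
  \<open>fps_right_inverse g 1\<close> is the (unique) multiplicative inverse of every series \<open>g\<close> with
  constant term 1; see \<open>eta_fps_mult_inverse\<close> below.
\<close>
definition M_seq :: "nat \<Rightarrow> int" where
  "M_seq n = fps_nth (eta_fps 2 ^ 5 * eta_fps 5 ^ 5 * fps_right_inverse (eta_fps 1 * eta_fps 10) 1) n"

definition T_star :: "nat \<Rightarrow> int" where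
  "T_star n = fps_nth (eta_fps 1 ^ 5 * eta_fps 10 ^ 5 * fps_right_inverse (eta_fps 2 * eta_fps 5) 1) n"

lemma eta_partial_prod_nth_stable:
  assumes k: "k > 0" and "m \<le> N" and "n \<le> m"
  shows "fps_nth (\<Prod>i\<le>N. 1 - fps_X ^ (k * Suc i) :: int fps) n =
         fps_nth (\<Prod>i\<le>m. 1 - fps_X ^ (k * Suc i)) n"
  using assms(2)
proof (induction N rule: dec_induct)
  case base
  then show ?case by simp
next
  case (step N)
  have "1 * Suc (Suc N) \<le> k * Suc (Suc N)" using k by (intro mult_right_mono) auto
  moreover have "n < 1 * Suc (Suc N)" using step.hyps(1) assms(3) by simp
  ultimately have lt: "n < k * Suc (Suc N)" by (rule less_le_trans[rotated])
  have "fps_nth (\<Prod>i\<le>Suc N. 1 - fps_X ^ (k * Suc i) :: int fps) n =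
        fps_nth ((\<Prod>i\<le>N. 1 - fps_X ^ (k * Suc i)) * (1 - fps_X ^ (k * Suc (Suc N)))) n"
    by simp
  also have "\<dots> = fps_nth (\<Prod>i\<le>N. 1 - fps_X ^ (k * Suc i) :: int fps) n"
    unfolding right_diff_distrib fps_sub_nth fps_X_power_mult_right_nth
    using lt by simp
  finally show ?case using step.IH by simp
qed

lemma eta_fps_has_prod_aux:
  assumes "k > 0"
  defines "P \<equiv> Abs_fps (\<lambda>n. fps_nth (\<Prod>i\<le>n. 1 - fps_X ^ (k * Suc i) :: int fps) n)"
  shows "(\<lambda>i. 1 - fps_X ^ (k * Suc i) :: int fps) has_prod P" and "fps_nth P 0 = 1"
proof -
  show P0: "fps_nth P 0 = 1"
    using assms by simp
  then have "P \<noteq> 0" by auto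
  moreover have "(\<lambda>N. \<Prod>i\<le>N. 1 - fps_X ^ (k * Suc i) :: int fps) \<longlonglongrightarrow> P"
    unfolding tendsto_fps_iff
  proof
    fix n
    show "\<forall>\<^sub>F N in sequentially. fps_nth (\<Prod>i\<le>N. 1 - fps_X ^ (k * Suc i) :: int fps) n = fps_nth P n"
      using eventually_ge_at_top[of n]
    proof eventually_elim
      case (elim N)
      then show ?case
        unfolding P_def by (simp only: fps_nth_Abs_fps eta_partial_prod_nth_stable[OF assms(1)])
    qed
  qed
  ultimately show "(\<lambda>i. 1 - fps_X ^ (k * Suc i) :: int fps) has_prod P"
    unfolding has_prod_def raw_has_prod_def by simp
qed

lemma eta_fps_has_prod:
  assumes "k > 0"
  shows "(\<lambda>i. 1 - fps_X ^ (k * Suc i)) has_prod eta_fps k"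
  unfolding eta_fps_def prodinf_def
proof (rule theI)
  show "(\<lambda>i. 1 - fps_X ^ (k * Suc i) :: int fps) has_prod
          Abs_fps (\<lambda>n. fps_nth (\<Prod>i\<le>n. 1 - fps_X ^ (k * Suc i) :: int fps) n)"
    by (rule eta_fps_has_prod_aux(1)[OF assms])
next
  fix p assume "(\<lambda>i. 1 - fps_X ^ (k * Suc i) :: int fps) has_prod p"
  then show "p = Abs_fps (\<lambda>n. fps_nth (\<Prod>i\<le>n. 1 - fps_X ^ (k * Suc i) :: int fps) n)"
    by (rule has_prod_unique2[OF _ eta_fps_has_prod_aux(1)[OF assms]])
qed

lemma eta_fps_nth_0:
  assumes "k > 0"
  shows "fps_nth (eta_fps k) 0 = 1"
  unfolding has_prod_unique2[OF eta_fps_has_prod[OF assms] eta_fps_has_prod_aux(1)[OF assms]]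
  by (rule eta_fps_has_prod_aux(2)[OF assms])

lemma eta_fps_mult_inverse:
  assumes "j > 0" "k > 0"
  shows "(eta_fps j * eta_fps k) * fps_right_inverse (eta_fps j * eta_fps k) 1 = 1"
  by (rule fps_right_inverse) (simp add: eta_fps_nth_0 assms)

end

theory Submission
  imports Defs "HOL-Computational_Algebra.Formal_Laurent_Series"
begin

text \<open>
  Write \<open>f\<^sub>k\<close> for \<open>eta_fps k\<close>. The factor \<open>f\<^sub>1\<^sub>0\<^sup>5 / f\<^sub>5\<close> of the generating function of \<open>T_star\<close> is a
  power series in \<open>q\<^sup>5\<close>, so selecting the exponents \<open>5n + 3\<close> turns it into a factor \<open>f\<^sub>2\<^sup>5 / f\<^sub>1\<close>
  and affects otherwise only \<open>f\<^sub>1\<^sup>5 / f\<^sub>2\<close>. This quotient is a product of two theta series,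
  \<open>f\<^sub>1\<^sup>5 / f\<^sub>2 = f\<^sub>1\<^sup>3 \<cdot> (f\<^sub>1\<^sup>2 / f\<^sub>2)\<close>, by the identities of Jacobi and Gauss:

  \<^item> \<open>f\<^sub>1\<^sup>3\<close> is the sum of \<open>(-1)\<^sup>k (2k + 1) q\<^bsup>k(k+1)/2\<^esup>\<close> over \<open>k \<ge> 0\<close> (lemma \<open>jacobi\<close>),
  \<^item> \<open>f\<^sub>1\<^sup>2 / f\<^sub>2\<close> is the sum of \<open>(-1)\<^sup>m q\<^bsup>m*m\<^esup>\<close> over all integers \<open>m\<close> (lemma \<open>gauss\<close>).

  The coefficient of \<open>q\<^sup>N\<close> in the product therefore runs over the solutions of
  \<open>8N + 1 = (2k + 1)\<^sup>2 + 8m\<^sup>2\<close>. For \<open>N \<equiv> 3\<close> modulo 5 the left side is divisible by 5, and since 2 is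
  not a square modulo 5, both \<open>2k + 1\<close> and \<open>m\<close> are divisible by 5. Dividing them by 5 preserves the
  parities of \<open>k\<close> and \<open>m\<close> and takes a factor 5 out of the weight \<open>2k + 1\<close>. So the selected part of
  \<open>f\<^sub>1\<^sup>5 / f\<^sub>2\<close>, with \<open>q\<^sup>n\<close> written for \<open>q\<^bsup>5n+3\<^esup>\<close>, is \<open>5\<close> times the same product in \<open>q\<^sup>5\<close>, that is \<open>5 f\<^sub>5\<^sup>5 / f\<^sub>1\<^sub>0\<close>
  (lemma \<open>theta_product_dissection\<close>). Multiplying by \<open>f\<^sub>2\<^sup>5 / f\<^sub>1\<close> gives the claim.

  The two theta identities are limits of finite identities, which are specialisations of the
  \<open>q\<close>-binomial theorem. Every passage to the limit is a congruence modulo \<open>q\<^sup>N\<close>.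
\<close>

section \<open>Elementary sums and products\<close>

lemma zero_choose_two [simp]: "0 choose 2 = 0"
  by (simp add: numeral_2_eq_2)

lemma choose_two_Suc: "Suc n choose 2 = (n choose 2) + n"
  by (simp add: numeral_2_eq_2)

lemma int_choose_two: "2 * int (n choose 2) = int n * (int n - 1)"
proof (induction n)
  case (Suc n)
  then show ?case by (simp add: choose_two_Suc algebra_simps)
qed (simp add: numeral_2_eq_2)

lemma prod_lessThan_add:
  "(\<Prod>i<m + n :: nat. f i) = (\<Prod>i<m. f i) * (\<Prod>i<n. f (m + i) :: 'a::comm_monoid_mult)"
  by (induction n) (auto simp: mult_ac)

lemma sum_lessThan_add:
  "(\<Sum>i<m + n :: nat. f i) = (\<Sum>i<m. f i) + (\<Sum>i<n. f (m + i) :: 'a::comm_monoid_add)"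
  by (induction n) (auto simp: add_ac)

lemma prod_neg_powers:
  "(\<Prod>i<n. - (q ^ i)) = (-1) ^ n * q ^ (n choose 2 :: nat)" for q :: "'a::comm_ring_1"
  by (induction n) (auto simp: choose_two_Suc power_add numeral_2_eq_2)

section \<open>Gaussian binomial coefficients\<close>

definition qpoch :: "'a::comm_ring_1 \<Rightarrow> nat \<Rightarrow> 'a" where
  "qpoch p m = (\<Prod>i<m. 1 - p ^ Suc i)"

text \<open>
  The recursion is one of the two \<open>q\<close>-Pascal rules. It needs no division, so that the base \<open>p\<close> may be
  an element of any commutative ring; below it is a power series or a constant polynomial.
\<close>
fun qbin :: "'a::comm_ring_1 \<Rightarrow> nat \<Rightarrow> nat \<Rightarrow> 'a" where
  "qbin p n 0 = 1"
| "qbin p 0 (Suc k) = 0"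
| "qbin p (Suc n) (Suc k) = qbin p n k + p ^ Suc k * qbin p n (Suc k)"

lemma qbin_eq_0: "n < k \<Longrightarrow> qbin p n k = 0"
  by (induction p n k rule: qbin.induct) auto

lemma qpoch_0 [simp]: "qpoch p 0 = 1"
  by (simp add: qpoch_def)

lemma qpoch_Suc: "qpoch p (Suc n) = qpoch p n * (1 - p ^ Suc n)"
  by (simp add: qpoch_def)

text \<open>
  The quotient formula for Gaussian binomials, with denominators cleared. Both terms of the Pascal
  rule become multiples of \<open>qpoch p n\<close>, with factors that add up to
  \<open>(1 - p\<^sup>a) + p\<^sup>a (1 - p\<^sup>b) = 1 - p\<^bsup>a+b\<^esup>\<close>.
\<close>
lemma qbin_qpoch:
  "qbin p (a + b) a * (qpoch p a * qpoch p b) = qpoch p (a + b)"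
proof (induction "a + b" arbitrary: a b)
  case 0
  then show ?case by simp
next
  case (Suc n)
  show ?case
  proof (cases a)
    case 0
    then show ?thesis by simp
  next
    case a: (Suc a')
    have 1: "qbin p n a' * (qpoch p a' * qpoch p b) = qpoch p n"
      using Suc.hyps(1)[of a' b] Suc.hyps(2) a by simp
    have 2: "qbin p n a * (qpoch p a * qpoch p b) = qpoch p n * (1 - p ^ b)"
    proof (cases b)
      case 0
      then show ?thesis using Suc.hyps(2) by (simp add: qbin_eq_0)
    next
      case b: (Suc b')
      have "qbin p n a * (qpoch p a * qpoch p b') = qpoch p n"
        using Suc.hyps(1)[of a b'] Suc.hyps(2) b by simp
      moreover have "qbin p n a * (qpoch p a * qpoch p b)
          = qbin p n a * (qpoch p a * qpoch p b') * (1 - p ^ b)"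
        by (simp only: b qpoch_Suc mult_ac)
      ultimately show ?thesis by simp
    qed
    have n: "a + b = Suc n" "n = a' + b" using Suc.hyps(2) a by auto
    have "qbin p (a + b) a * (qpoch p a * qpoch p b)
        = qbin p n a' * (qpoch p a' * qpoch p b) * (1 - p ^ a)
          + p ^ a * (qbin p n a * (qpoch p a * qpoch p b))"
      unfolding n(1) by (simp add: a qpoch_Suc algebra_simps)
    also have "\<dots> = qpoch p n * (1 - p ^ (a + b))"
      unfolding 1 2 by (simp add: algebra_simps power_add)
    also have "\<dots> = qpoch p (a + b)"
      unfolding n(1) by (simp add: qpoch_Suc)
    finally show ?thesis .
  qed
qed

text \<open>
  The \<open>q\<close>-binomial theorem is kept homogeneous in \<open>x\<close> and \<open>y\<close> because the finite theta identities
  arise by taking \<open>y\<close> to be a power of the base, where an inhomogeneous form would require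
  negative powers. The induction splits off the factor \<open>y + x\<close> and replaces \<open>x\<close> by \<open>x p\<close>.
\<close>
theorem q_binomial:
  "(\<Prod>i<n. y + x * p ^ i) = (\<Sum>j\<le>n. p ^ (j choose 2) * qbin p n j * x ^ j * y ^ (n - j))"
proof (induction n arbitrary: x)
  case 0
  then show ?case by (simp add: numeral_2_eq_2)
next
  case (Suc n)
  let ?t = "\<lambda>j. p ^ (Suc j choose 2) * qbin p n j * x ^ j * y ^ (n - j)"
  have t: "p ^ (j choose 2) * qbin p n j * (x * p) ^ j * y ^ (n - j)
      = p ^ (Suc j choose 2) * qbin p n j * x ^ j * y ^ (n - j)" for j
    by (simp add: choose_two_Suc power_add power_mult_distrib algebra_simps)
  have y: "y * ?t (Suc j)
      = p ^ (Suc j choose 2) * (p ^ Suc j * qbin p n (Suc j)) * x ^ Suc j * y ^ (n - j)" for j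
  proof (cases "j < n")
    case True
    then have "y ^ (n - j) = y * y ^ (n - Suc j)"
      by (metis Suc_diff_Suc power_Suc)
    then show ?thesis by (simp add: choose_two_Suc power_add algebra_simps)
  next
    case False
    then show ?thesis by (simp add: qbin_eq_0)
  qed
  have s: "(\<Sum>j\<le>n. ?t j) = y ^ n + (\<Sum>j\<le>n. ?t (Suc j))"
  proof -
    have "(\<Sum>j\<le>n. ?t j) = (\<Sum>j\<le>Suc n. ?t j)"
      by (simp add: qbin_eq_0)
    also have "\<dots> = ?t 0 + (\<Sum>j\<le>n. ?t (Suc j))"
      by (rule sum.atMost_Suc_shift)
    finally show ?thesis by (simp add: numeral_2_eq_2)
  qed
  have "(\<Prod>i<Suc n. y + x * p ^ i) = (y + x) * (\<Prod>i<n. y + x * p * p ^ i)"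
    by (subst prod.lessThan_Suc_shift) (simp add: mult.assoc)
  also have "\<dots> = (y + x) * (\<Sum>j\<le>n. ?t j)"
    unfolding Suc.IH t ..
  also have "\<dots> = y * (y ^ n + (\<Sum>j\<le>n. ?t (Suc j))) + x * (\<Sum>j\<le>n. ?t j)"
    unfolding s[symmetric] by (simp add: algebra_simps)
  also have "\<dots> = y ^ Suc n + (\<Sum>j\<le>n. y * ?t (Suc j) + x * ?t j)"
    by (simp add: sum_distrib_left sum.distrib algebra_simps)
  also have "\<dots> = y ^ Suc n + (\<Sum>j\<le>n. p ^ (Suc j choose 2) * qbin p (Suc n) (Suc j)
                       * x ^ Suc j * y ^ (Suc n - Suc j))"
    unfolding y by (simp add: algebra_simps)
  also have "\<dots> = (\<Sum>j\<le>Suc n. p ^ (j choose 2) * qbin p (Suc n) j * x ^ j * y ^ (Suc n - j))"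
    by (subst sum.atMost_Suc_shift) simp
  finally show ?case .
qed

section \<open>Congruence of power series modulo powers of the variable\<close>

definition fps_agree :: "nat \<Rightarrow> 'a fps \<Rightarrow> 'a fps \<Rightarrow> bool" where
  "fps_agree N a b \<longleftrightarrow> (\<forall>i<N. fps_nth a i = fps_nth b i)"

lemma fps_agree_refl [simp]: "fps_agree N a a"
  by (simp add: fps_agree_def)

lemma fps_agree_sym: "fps_agree N a b \<Longrightarrow> fps_agree N b a"
  by (simp add: fps_agree_def)

lemma fps_agree_trans [trans]: "fps_agree N a b \<Longrightarrow> fps_agree N b c \<Longrightarrow> fps_agree N a c"
  by (simp add: fps_agree_def)

lemma fps_agree_mult:
  "fps_agree N a c \<Longrightarrow> fps_agree N b d \<Longrightarrow> fps_agree N (a * b) (c * d)"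
  by (auto simp: fps_agree_def fps_mult_nth intro!: sum.cong)

lemma fps_agree_power: "fps_agree N a b \<Longrightarrow> fps_agree N (a ^ k) (b ^ k)"
  by (induction k) (auto intro: fps_agree_mult)

lemma fps_agree_diff:
  "fps_agree N a c \<Longrightarrow> fps_agree N b d \<Longrightarrow> fps_agree N (a - b) (c - d :: 'a::group_add fps)"
  by (auto simp: fps_agree_def)

lemma fps_agree_sum:
  "(\<And>x. x \<in> S \<Longrightarrow> fps_agree N (f x) (g x)) \<Longrightarrow> fps_agree N (sum f S) (sum g S)"
  by (auto simp: fps_agree_def fps_sum_nth intro!: sum.cong)

text \<open>
  Multiplication by \<open>X\<^sup>k\<close> gains \<open>k\<close> orders of precision. This makes up for the loss of precision of
  \<open>eta_mult_qbin_agree\<close> away from the central binomial coefficients.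
\<close>
lemma fps_agree_X_power_mult:
  "fps_agree N a b \<Longrightarrow> M \<le> k + N \<Longrightarrow>
   fps_agree M (fps_X ^ k * a) (fps_X ^ k * b :: 'a::comm_ring_1 fps)"
  by (auto simp: fps_agree_def fps_X_power_mult_nth)

lemma fps_agree_cancel:
  fixes f :: "'a::comm_ring_1 fps"
  assumes "fps_nth f 0 = 1" "fps_agree N (f * a) (f * b)"
  shows "fps_agree N a b"
proof -
  define g where "g = fps_right_inverse f 1"
  have g: "g * f = 1"
    unfolding g_def using fps_right_inverse[of f 1] assms(1) by (simp add: mult.commute)
  have "fps_agree N (g * (f * a)) (g * (f * b))"
    by (intro fps_agree_mult assms(2)) simp
  then show ?thesis
    by (simp add: mult.assoc[symmetric] g)
qed

lemma fps_eqI_agree: "(\<And>N. fps_agree N a b) \<Longrightarrow> a = b"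
  by (auto simp: fps_agree_def fps_eq_iff)

lemma eta_fps_nth:
  assumes "k > 0"
  shows "fps_nth (eta_fps k) n = fps_nth (\<Prod>i\<le>n. 1 - fps_X ^ (k * Suc i)) n"
  using has_prod_unique2[OF eta_fps_has_prod[OF assms] eta_fps_has_prod_aux(1)[OF assms]]
  by simp

lemma eta_fps_agree_qpoch:
  assumes "k > 0" "m \<ge> N"
  shows "fps_agree N (eta_fps k) (qpoch (fps_X ^ k) m)"
  unfolding fps_agree_def
proof (intro allI impI)
  fix i assume "i < N"
  with assms obtain m' where m: "m = Suc m'" "i \<le> m'"
    by (cases m) auto
  have "qpoch (fps_X ^ k) m = (\<Prod>i\<le>m'. 1 - fps_X ^ (k * Suc i) :: int fps)"
    by (simp only: qpoch_def m(1) lessThan_Suc_atMost power_mult)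
  then show "fps_nth (eta_fps k) i = fps_nth (qpoch (fps_X ^ k) m) i"
    using eta_fps_nth[OF assms(1), of i] eta_partial_prod_nth_stable[OF assms(1) m(2), of i] by simp
qed

text \<open>
  Far from both ends of its row, a Gaussian binomial is close to \<open>1 / f\<^sub>k\<close>: in \<open>qbin_qpoch\<close> all three
  finite products are congruent to \<open>f\<^sub>k\<close>, and one factor \<open>f\<^sub>k\<close> cancels.
\<close>
lemma eta_mult_qbin_agree:
  assumes k: "k > 0" and "N \<le> a" "N \<le> b"
  shows "fps_agree N (eta_fps k * qbin (fps_X ^ k) (a + b) a) 1"
proof (rule fps_agree_cancel)
  let ?f = "eta_fps k" and ?q = "qpoch (fps_X ^ k :: int fps)"
  show "fps_nth ?f 0 = 1" by (rule eta_fps_nth_0[OF k])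
  have "fps_agree N (qbin (fps_X ^ k) (a + b) a * (?f * ?f))
          (qbin (fps_X ^ k) (a + b) a * (?q a * ?q b))"
    by (intro fps_agree_mult eta_fps_agree_qpoch assms fps_agree_refl)
  also have "\<dots> = ?q (a + b)" by (rule qbin_qpoch)
  also have "fps_agree N \<dots> ?f"
    using assms by (intro fps_agree_sym[OF eta_fps_agree_qpoch]) auto
  finally show "fps_agree N (?f * (?f * qbin (fps_X ^ k) (a + b) a)) (?f * 1)"
    by (simp add: mult_ac)
qed

section \<open>Two theta series\<close>

definition gauss_theta :: "int fps" where
  "gauss_theta = Abs_fps (\<lambda>n. \<Sum>m | m\<^sup>2 = int n. (-1) ^ nat \<bar>m\<bar>)"

definition jacobi_theta :: "int fps" where
  "jacobi_theta = Abs_fps (\<lambda>n. \<Sum>k | Suc k choose 2 = n. (-1) ^ k * int (2 * k + 1))"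

text \<open>
  A finite sum of monomials approximates the formal infinite sum once every omitted
  exponent is at least the precision.
\<close>
lemma fps_agree_sum_X_power:
  fixes c :: "'b \<Rightarrow> 'a::comm_ring_1"
  assumes "finite S" and out: "\<And>x. x \<notin> S \<Longrightarrow> N \<le> e x"
  shows "fps_agree N (\<Sum>x\<in>S. fps_const (c x) * fps_X ^ e x) (Abs_fps (\<lambda>n. \<Sum>x | e x = n. c x))"
  unfolding fps_agree_def
proof (intro allI impI)
  fix i assume "i < N"
  have "{x \<in> S. i = e x} = {x. e x = i}"
    using out \<open>i < N\<close> by force
  then have "(\<Sum>x\<in>S. if i = e x then c x else 0) = (\<Sum>x | e x = i. c x)"
    using assms(1) by (simp add: sum.inter_filter[symmetric])
  then show "fps_nth (\<Sum>x\<in>S. fps_const (c x) * fps_X ^ e x) i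
        = fps_nth (Abs_fps (\<lambda>n. \<Sum>x | e x = n. c x)) i"
    by (simp add: fps_sum_nth if_distrib cong: if_cong)
qed

section \<open>The theta identity of Gauss\<close>

text \<open>
  This is the \<open>q\<close>-binomial theorem with base \<open>q\<^sup>2\<close>, \<open>x = -1\<close> and \<open>y = q\<^bsup>2N-1\<^esup>\<close>: the factors
  \<open>q\<^bsup>2N-1\<^esup> - q\<^bsup>2i\<^esup>\<close> with \<open>i < N\<close> and those with \<open>i \<ge> N\<close> each give the product of the first
  \<open>N\<close> odd factors, up to sign and a power of \<open>q\<close>. With \<open>j = N + m\<close>, completing the square in the exponent
  of the \<open>j\<close>-th summand yields the same power of \<open>q\<close> times \<open>q\<^bsup>m*m\<^esup>\<close>.
\<close>
lemma finite_gauss: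
  fixes q :: "'a::idom"
  assumes "N > 0" and q: "q \<noteq> 0"
  shows "(\<Prod>i<N. 1 - q ^ (2 * i + 1))\<^sup>2 =
    (\<Sum>m\<in>{- int N..int N}. (-1) ^ nat \<bar>m\<bar> * q ^ nat (m\<^sup>2) * qbin (q\<^sup>2) (2 * N) (nat (int N + m)))"
    (is "?D\<^sup>2 = (\<Sum>m\<in>_. ?g m)")
proof -
  \<comment> \<open>The power of \<open>q\<close> common to both sides, to be cancelled at the end.\<close>
  define E where "E = 2 * (N choose 2) + (2 * N - 1) * N"
  have 1: "(\<Prod>i<N. q ^ (2 * N - 1) + (-1) * (q\<^sup>2) ^ i) = (-1) ^ N * q ^ (2 * (N choose 2)) * ?D"
  proof -
    have "q ^ (2 * N - 1) + (-1) * (q\<^sup>2) ^ i = - ((q\<^sup>2) ^ i) * (1 - q ^ (2 * (N - Suc i) + 1))"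
      if "i < N" for i
    proof -
      have "2 * N - 1 = 2 * i + (2 * (N - Suc i) + 1)" using that by simp
      then have "q ^ (2 * N - 1) = q ^ (2 * i) * q ^ (2 * (N - Suc i) + 1)"
        by (metis power_add)
      then show ?thesis by (simp add: algebra_simps flip: power_mult)
    qed
    then have "(\<Prod>i<N. q ^ (2 * N - 1) + (-1) * (q\<^sup>2) ^ i)
        = (\<Prod>i<N. - ((q\<^sup>2) ^ i)) * (\<Prod>i<N. 1 - q ^ (2 * (N - Suc i) + 1))"
      by (simp flip: prod.distrib)
    also have "(\<Prod>i<N. 1 - q ^ (2 * (N - Suc i) + 1)) = ?D"
      by (rule prod.nat_diff_reindex)
    finally show ?thesis by (simp only: prod_neg_powers power_mult)
  qed
  have 2: "(\<Prod>i<N. q ^ (2 * N - 1) + (-1) * (q\<^sup>2) ^ (N + i)) = q ^ ((2 * N - 1) * N) * ?D"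
  proof -
    have "q ^ (2 * N - 1) + (-1) * (q\<^sup>2) ^ (N + i) = q ^ (2 * N - 1) * (1 - q ^ (2 * i + 1))" for i
    proof -
      have "2 * (N + i) = (2 * N - 1) + (2 * i + 1)" using assms by simp
      then have "(q\<^sup>2) ^ (N + i) = q ^ (2 * N - 1) * q ^ (2 * i + 1)"
        by (metis power_add power_mult)
      then show ?thesis by (simp add: algebra_simps)
    qed
    then show ?thesis by (simp add: prod.distrib power_mult)
  qed
  have 3: "(q\<^sup>2) ^ (j choose 2) * qbin (q\<^sup>2) (2 * N) j * (-1) ^ j * (q ^ (2 * N - 1)) ^ (2 * N - j)
      = (-1) ^ N * q ^ E * ?g (int j - int N)" if "j \<le> 2 * N" for j
  proof -
    have "int (2 * (n choose 2)) = int n * (int n - 1)" for n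
      by (simp add: int_choose_two)
    moreover have "int (2 * N - 1) = 2 * int N - 1" "int (2 * N - j) = 2 * int N - int j"
        "int (nat ((int j - int N)\<^sup>2)) = (int j - int N)\<^sup>2"
      using that assms by (simp_all add: of_nat_diff)
    ultimately have "int (2 * (j choose 2) + (2 * N - 1) * (2 * N - j))
        = int (E + nat ((int j - int N)\<^sup>2))"
      unfolding E_def by (simp only: of_nat_add of_nat_mult) (simp add: power2_eq_square algebra_simps)
    then have "q ^ (2 * (j choose 2) + (2 * N - 1) * (2 * N - j)) = q ^ (E + nat ((int j - int N)\<^sup>2))"
      by (simp only: of_nat_eq_iff)
    then have e: "(q\<^sup>2) ^ (j choose 2) * (q ^ (2 * N - 1)) ^ (2 * N - j)
        = q ^ E * q ^ nat ((int j - int N)\<^sup>2)"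
      by (simp only: power_add power_mult)
    have "even (j + (N + nat \<bar>int j - int N\<bar>))"
      by (cases "j \<le> N") (auto simp: nat_diff_distrib even_nat_iff)
    then have s: "(-1) ^ j = (-1) ^ N * (-1 :: 'a) ^ nat \<bar>int j - int N\<bar>"
      by (metis even_add minus_one_power_iff power_add)
    show ?thesis
      using arg_cong[OF e, of "\<lambda>t. t * qbin (q\<^sup>2) (2 * N) j * (-1) ^ j"]
      by (simp add: s mult_ac)
  qed
  have "(-1) ^ N * q ^ E * ?D\<^sup>2 = (\<Prod>i<N + N. q ^ (2 * N - 1) + (-1) * (q\<^sup>2) ^ i)"
    unfolding prod_lessThan_add 1 2 E_def by (simp add: power_add power2_eq_square mult_ac)
  also have "\<dots> = (\<Sum>j\<le>2 * N. (-1) ^ N * q ^ E * ?g (int j - int N))"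
    unfolding q_binomial mult_2[symmetric] by (intro sum.cong refl 3) simp
  also have "\<dots> = (-1) ^ N * q ^ E * (\<Sum>j\<le>2 * N. ?g (int j - int N))"
    by (rule sum_distrib_left[symmetric])
  also have "(\<Sum>j\<le>2 * N. ?g (int j - int N)) = (\<Sum>m\<in>{- int N..int N}. ?g m)"
    by (rule sum.reindex_bij_witness[of _ "\<lambda>m. nat (int N + m)" "\<lambda>j. int j - int N"]) auto
  finally show ?thesis using q by simp
qed

lemma odd_factors_mult_qpoch:
  "(\<Prod>i<N. 1 - q ^ (2 * i + 1)) * qpoch (q\<^sup>2) N = qpoch q (2 * N)"
proof (induction N)
  case (Suc N)
  have "qpoch q (2 * Suc N) = qpoch q (2 * N) * (1 - q ^ (2 * N + 1)) * (1 - (q\<^sup>2) ^ Suc N)"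
    using power_mult[of q 2 "Suc N", symmetric] by (simp only: qpoch_Suc mult_Suc_right) (simp add: qpoch_Suc)
  then show ?case
    unfolding Suc.IH[symmetric] by (simp add: qpoch_Suc mult_ac)
qed simp

text \<open>
  Multiplied by \<open>f\<^sub>2\<^sup>2\<close>, the left side of \<open>finite_gauss\<close> tends to \<open>f\<^sub>1\<^sup>2\<close>, as the odd and even factors
  recombine. On the right one factor \<open>f\<^sub>2\<close> absorbs the Gaussian binomials. The \<open>m\<close>-th binomial is only
  controlled up to order \<open>N - \<bar>m\<bar>\<close>, but its factor \<open>q\<^bsup>m*m\<^esup>\<close> compensates since \<open>\<bar>m\<bar> \<le> m\<^sup>2\<close>.
\<close>
theorem gauss: "eta_fps 1 ^ 2 = eta_fps 2 * gauss_theta"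
proof (rule fps_eqI_agree)
  fix N :: nat
  show "fps_agree N (eta_fps 1 ^ 2) (eta_fps 2 * gauss_theta)"
  proof (cases "N = 0")
    case True
    then show ?thesis by (simp add: fps_agree_def)
  next
    case False
    let ?X = "fps_X :: int fps"
    let ?D = "\<Prod>i<N. 1 - ?X ^ (2 * i + 1)"
    let ?c = "\<lambda>m::int. (-1) ^ nat \<bar>m\<bar> :: int"
    let ?b = "\<lambda>m. qbin (?X\<^sup>2) (2 * N) (nat (int N + m))"
    have "fps_agree N (eta_fps 1) (qpoch (?X ^ 1) (2 * N))"
      by (rule eta_fps_agree_qpoch) auto
    also have "qpoch (?X ^ 1) (2 * N) = ?D * qpoch (?X\<^sup>2) N"
      by (simp only: power_one_right odd_factors_mult_qpoch)
    also have "fps_agree N \<dots> (?D * eta_fps 2)"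
      by (intro fps_agree_mult fps_agree_refl fps_agree_sym[OF eta_fps_agree_qpoch]) auto
    finally have "fps_agree N (eta_fps 1 ^ 2) ((?D * eta_fps 2) ^ 2)"
      by (rule fps_agree_power)
    also have "(?D * eta_fps 2) ^ 2 = eta_fps 2 * (eta_fps 2 * ?D\<^sup>2)"
      by (simp add: power2_eq_square mult_ac)
    also have "?D\<^sup>2 = (\<Sum>m\<in>{- int N..int N}. (-1) ^ nat \<bar>m\<bar> * ?X ^ nat (m\<^sup>2) * ?b m)"
      using False by (intro finite_gauss) auto
    also have "eta_fps 2 * \<dots> = (\<Sum>m\<in>{- int N..int N}. ?X ^ nat (m\<^sup>2) * (fps_const (?c m) * (eta_fps 2 * ?b m)))"
      by (simp add: sum_distrib_left mult_ac flip: fps_const_power fps_const_neg)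
    also have "fps_agree N (eta_fps 2 * \<dots>)
        (eta_fps 2 * (\<Sum>m\<in>{- int N..int N}. ?X ^ nat (m\<^sup>2) * (fps_const (?c m) * 1)))"
    proof (rule fps_agree_mult[OF fps_agree_refl fps_agree_sum])
      fix m assume m: "m \<in> {- int N..int N}"
      define a b where "a = nat (int N + m)" and "b = nat (int N - m)"
      have ab: "2 * N = a + b" and "N - nat \<bar>m\<bar> \<le> a" "N - nat \<bar>m\<bar> \<le> b"
        using m by (auto simp: a_def b_def)
      then have "fps_agree (N - nat \<bar>m\<bar>) (eta_fps 2 * ?b m) 1"
        unfolding a_def[symmetric] ab by (intro eta_mult_qbin_agree) auto
      moreover have "\<bar>m\<bar> * 1 \<le> \<bar>m\<bar> * \<bar>m\<bar>"
        by (cases "m = 0") (auto intro!: mult_left_mono simp del: mult_cancel_left2 abs_mult_self_eq)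
      then have "nat \<bar>m\<bar> \<le> nat (m\<^sup>2)"
        by (intro nat_mono) (simp add: power2_eq_square)
      then have "N \<le> nat (m\<^sup>2) + (N - nat \<bar>m\<bar>)" by linarith
      ultimately show "fps_agree N (?X ^ nat (m\<^sup>2) * (fps_const (?c m) * (eta_fps 2 * ?b m)))
          (?X ^ nat (m\<^sup>2) * (fps_const (?c m) * 1))"
        by (blast intro: fps_agree_X_power_mult fps_agree_mult fps_agree_refl)
    qed
    also have "fps_agree N \<dots> (eta_fps 2 * gauss_theta)"
    proof (intro fps_agree_mult fps_agree_refl)
      have "fps_agree N (\<Sum>m\<in>{- int N..int N}. fps_const (?c m) * ?X ^ nat (m\<^sup>2))
          (Abs_fps (\<lambda>n. \<Sum>m | nat (m\<^sup>2) = n. ?c m))"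
      proof (rule fps_agree_sum_X_power)
        fix m assume "m \<notin> {- int N..int N}"
        then have "int N \<le> \<bar>m\<bar>" "1 \<le> \<bar>m\<bar>" by auto
        then have "int N * 1 \<le> \<bar>m\<bar> * \<bar>m\<bar>" by (intro mult_mono) auto
        then show "N \<le> nat (m\<^sup>2)" by (simp add: power2_eq_square)
      qed simp
      moreover have "nat (m\<^sup>2) = n \<longleftrightarrow> m\<^sup>2 = int n" for m n by auto
      ultimately show "fps_agree N (\<Sum>m\<in>{- int N..int N}. ?X ^ nat (m\<^sup>2) * (fps_const (?c m) * 1)) gauss_theta"
        by (simp add: gauss_theta_def mult_ac)
    qed
    finally show ?thesis .
  qed
qed

section \<open>The cube of Euler's product\<close>

text \<open>
  The \<open>q\<close>-binomial theorem is applied in a polynomial ring, with \<open>x = -z\<close> for the polynomial variable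
  \<open>z\<close> and \<open>y = q\<^sup>N\<close>. The middle one of the \<open>2N + 1\<close> factors \<open>q\<^sup>N - z q\<^sup>i\<close> is \<open>q\<^sup>N (1 - z)\<close>, so the
  derivative at \<open>z = 1\<close> is, up to the factor \<open>-q\<^sup>N\<close>, the product of the remaining factors at \<open>z = 1\<close>.
  The \<open>N\<close> factors on either side of the middle give \<open>qpoch q N\<close> each. On the other side of the
  identity, the derivative at 1 weights the \<open>j\<close>-th coefficient by \<open>j\<close>; the summands \<open>j = N - k\<close> and
  \<open>j = N + 1 + k\<close> carry the same power of \<open>q\<close> and opposite signs, and are paired.
\<close>
lemma finite_jacobi:
  fixes q :: "'a::idom"
  assumes q: "q \<noteq> 0"
  shows "(qpoch q N)\<^sup>2 = (\<Sum>k\<le>N. (-1) ^ k * q ^ (Suc k choose 2) *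
    (of_nat (Suc N + k) * qbin q (2 * N + 1) (Suc N + k) - of_nat (N - k) * qbin q (2 * N + 1) (N - k)))"
proof -
  let ?n = "2 * N + 1"
  \<comment> \<open>The power of \<open>q\<close> common to both sides, to be cancelled at the end.\<close>
  define E where "E = (N choose 2) + N * N + N"
  define c where "c j = (-1) ^ j * q ^ ((j choose 2) + N * (?n - j)) * qbin q ?n j" for j
  \<comment> \<open>The factors before and after the middle one.\<close>
  define L R where "L = (\<Prod>i<N. [:q ^ N, - (q ^ i):])" and "R = (\<Prod>i<N. [:q ^ N, - (q ^ (Suc N + i)):])"
  have "(\<Prod>i<?n. [:q ^ N:] + [:0, -1:] * [:q:] ^ i)
      = (\<Sum>j\<le>?n. [:q:] ^ (j choose 2) * qbin [:q:] ?n j * [:0, -1:] ^ j * [:q ^ N:] ^ (?n - j))"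
    by (rule q_binomial)
  also have "(\<Prod>i<?n. [:q ^ N:] + [:0, -1:] * [:q:] ^ i) = (\<Prod>i<Suc N + N. [:q ^ N, - (q ^ i):])"
    by (simp add: poly_const_pow mult_2)
  also have "\<dots> = [:q ^ N, - (q ^ N):] * (L * R)"
    unfolding prod_lessThan_add prod.lessThan_Suc L_def R_def by (simp only: mult_ac)
  also have "(\<Sum>j\<le>?n. [:q:] ^ (j choose 2) * qbin [:q:] ?n j * [:0, -1:] ^ j * [:q ^ N:] ^ (?n - j))
      = (\<Sum>j\<le>?n. monom (c j) j)"
  proof (rule sum.cong)
    have b: "qbin [:q:] n j = [:qbin q n j:]" for n j
      by (induction q n j rule: qbin.induct) (auto simp: poly_const_pow one_pCons)
    have x: "[:0, -1:] ^ j = smult ((-1) ^ j) (monom 1 j)" for j :: nat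
      by (induction j) (simp_all add: monom_Suc mult.commute)
    show "[:q:] ^ (j choose 2) * qbin [:q:] ?n j * [:0, -1:] ^ j * [:q ^ N:] ^ (?n - j) = monom (c j) j" for j
      unfolding b x c_def by (simp add: poly_const_pow smult_monom power_add power_mult mult_ac)
  qed simp
  finally have P: "[:q ^ N, - (q ^ N):] * (L * R) = (\<Sum>j\<le>?n. monom (c j) j)" .
  have deriv: "poly (pderiv (\<Sum>j\<in>A. monom (c j) j)) 1 = (\<Sum>j\<in>A. of_nat j * c j)" for A
    by (induction A rule: infinite_finite_induct) (simp_all add: pderiv_add pderiv_monom poly_monom)
  have "- (q ^ N) * poly (L * R) 1 = poly (pderiv ([:q ^ N, - (q ^ N):] * (L * R))) 1"
    by (subst pderiv_mult) (simp add: pderiv_pCons)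
  also have "\<dots> = (\<Sum>j\<le>?n. of_nat j * c j)"
    unfolding P by (rule deriv)
  also have "\<dots> = (\<Sum>j<Suc N + Suc N. of_nat j * c j)"
    by (rule sum.cong) auto
  also have "\<dots> = (\<Sum>j<Suc N. of_nat j * c j) + (\<Sum>k<Suc N. of_nat (Suc N + k) * c (Suc N + k))"
    by (rule sum_lessThan_add)
  also have "(\<Sum>j<Suc N. of_nat j * c j) = (\<Sum>k<Suc N. of_nat (N - k) * c (N - k))"
    by (subst sum.nat_diff_reindex[symmetric]) (simp only: diff_Suc_Suc)
  finally have 1: "- (q ^ N) * poly (L * R) 1
      = (\<Sum>k\<le>N. of_nat (N - k) * c (N - k) + of_nat (Suc N + k) * c (Suc N + k))"
    by (simp only: sum.distrib lessThan_Suc_atMost)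
  have "poly L 1 = (\<Prod>i<N. - (q ^ i) * (1 - q ^ Suc (N - Suc i)))"
    unfolding L_def poly_prod
  proof (rule prod.cong)
    fix i assume "i \<in> {..<N}"
    then have "q ^ N = q ^ i * q ^ Suc (N - Suc i)"
      by (metis Suc_diff_Suc diff_Suc_1 le_add_diff_inverse lessThan_iff less_imp_le_nat power_add)
    then show "poly [:q ^ N, - (q ^ i):] 1 = - (q ^ i) * (1 - q ^ Suc (N - Suc i))"
      by (simp add: algebra_simps)
  qed simp
  also have "\<dots> = (-1) ^ N * q ^ (N choose 2) * qpoch q N"
    unfolding prod.distrib prod_neg_powers qpoch_def
    by (simp only: prod.nat_diff_reindex[of "\<lambda>i. 1 - q ^ Suc i"])
  finally have L: "poly L 1 = (-1) ^ N * q ^ (N choose 2) * qpoch q N" .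
  have "poly R 1 = (\<Prod>i<N. q ^ N * (1 - q ^ Suc i))"
    unfolding R_def poly_prod by (intro prod.cong) (simp_all add: power_add algebra_simps)
  then have R: "poly R 1 = q ^ (N * N) * qpoch q N"
    by (simp add: prod.distrib qpoch_def power_mult)
  have cl: "c (N - k) = (-1) ^ N * q ^ E * ((-1) ^ k * q ^ (Suc k choose 2) * qbin q ?n (N - k))"
    if k: "k \<le> N" for k
  proof -
    obtain d where d: "N = k + d" using le_Suc_ex[OF k] by auto
    have "2 * ((d choose 2) + N * (?n - d)) = 2 * (E + (Suc k choose 2))"
    proof -
      have "?n - d = 2 * k + d + 1" using d by simp
      then have "int (2 * ((d choose 2) + N * (?n - d))) = int (2 * (E + (Suc k choose 2)))"
        unfolding E_def of_nat_mult of_nat_add distrib_left of_nat_numeral int_choose_two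
        by (simp add: d algebra_simps)
      then show ?thesis by (simp only: of_nat_eq_iff)
    qed
    then have e: "(d choose 2) + N * (?n - d) = E + (Suc k choose 2)" by simp
    have s: "(-1 :: 'a) ^ d = (-1) ^ N * (-1) ^ k"
      by (simp add: d power_add mult_ac flip: power_mult_distrib)
    have "N - k = d" using d by simp
    then show ?thesis by (simp only: c_def e s) (simp only: power_add mult_ac)
  qed
  have cr: "c (Suc N + k) = - ((-1) ^ N * q ^ E * ((-1) ^ k * q ^ (Suc k choose 2) * qbin q ?n (Suc N + k)))"
    if k: "k \<le> N" for k
  proof -
    obtain d where d: "N = k + d" using le_Suc_ex[OF k] by auto
    have "2 * ((Suc N + k choose 2) + N * (?n - (Suc N + k))) = 2 * (E + (Suc k choose 2))"
    proof -
      have "?n - (Suc N + k) = d" using d by simp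
      then have "int (2 * ((Suc N + k choose 2) + N * (?n - (Suc N + k)))) = int (2 * (E + (Suc k choose 2)))"
        unfolding E_def of_nat_mult of_nat_add distrib_left of_nat_numeral int_choose_two
        by (simp add: d algebra_simps)
      then show ?thesis by (simp only: of_nat_eq_iff)
    qed
    then have e: "(Suc N + k choose 2) + N * (?n - (Suc N + k)) = E + (Suc k choose 2)" by simp
    have s: "(-1 :: 'a) ^ (Suc N + k) = - ((-1) ^ N * (-1) ^ k)"
      by (simp add: power_add)
    show ?thesis by (simp only: c_def e s) (simp only: power_add mult_minus_left mult_minus_right mult_ac)
  qed
  have "(-1) ^ N * q ^ E * (qpoch q N)\<^sup>2 = q ^ N * poly (L * R) 1"
    by (simp add: L R E_def power_add power2_eq_square mult_ac)
  also have "\<dots> = - (\<Sum>k\<le>N. of_nat (N - k) * c (N - k) + of_nat (Suc N + k) * c (Suc N + k))"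
    unfolding 1[symmetric] by simp
  also have "\<dots> = (\<Sum>k\<le>N. (-1) ^ N * q ^ E * ((-1) ^ k * q ^ (Suc k choose 2) *
      (of_nat (Suc N + k) * qbin q ?n (Suc N + k) - of_nat (N - k) * qbin q ?n (N - k))))"
    unfolding sum_negf[symmetric]
  proof (rule sum.cong)
    fix k assume "k \<in> {..N}"
    then have k: "k \<le> N" by simp
    show "- (of_nat (N - k) * c (N - k) + of_nat (Suc N + k) * c (Suc N + k)) =
        (-1) ^ N * q ^ E * ((-1) ^ k * q ^ (Suc k choose 2) *
        (of_nat (Suc N + k) * qbin q ?n (Suc N + k) - of_nat (N - k) * qbin q ?n (N - k)))"
    proof -
      have "- (a * (e * (w * x)) + b * - (e * (w * y))) = e * (w * (b * y - a * x))" for a b e w x y :: 'a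
        by (simp add: algebra_simps)
      then show ?thesis unfolding cl[OF k] cr[OF k] .
    qed
  qed simp
  finally show ?thesis
    unfolding sum_distrib_left[symmetric] using q by simp
qed

text \<open>
  Multiplied by \<open>f\<^sub>1\<close>, both Gaussian binomials of the \<open>k\<close>-th summand of \<open>finite_jacobi\<close> become
  congruent to 1, which leaves the weight \<open>(N + 1 + k) - (N - k) = 2k + 1\<close>. The congruences hold up to
  order \<open>N - k\<close>, and the factor with the triangular exponent \<open>k(k+1)/2 \<ge> k\<close> compensates.
\<close>
theorem jacobi: "eta_fps 1 ^ 3 = jacobi_theta"
proof (rule fps_eqI_agree)
  fix N :: nat
  let ?X = "fps_X :: int fps" and ?n = "2 * N + 1"
  have "fps_agree N (eta_fps 1 ^ 2) (qpoch (?X ^ 1) N ^ 2)"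
    by (intro fps_agree_power eta_fps_agree_qpoch) auto
  then have "fps_agree N (eta_fps 1 * eta_fps 1 ^ 2) (eta_fps 1 * qpoch ?X N ^ 2)"
    by (intro fps_agree_mult fps_agree_refl) simp
  also have "eta_fps 1 * qpoch ?X N ^ 2 = (\<Sum>k\<le>N. ?X ^ (Suc k choose 2) * ((-1) ^ k *
      (of_nat (Suc N + k) * (eta_fps 1 * qbin ?X ?n (Suc N + k))
       - of_nat (N - k) * (eta_fps 1 * qbin ?X ?n (N - k)))))"
    by (subst finite_jacobi) (simp_all add: sum_distrib_left algebra_simps)
  also have "fps_agree N \<dots> (\<Sum>k\<le>N. ?X ^ (Suc k choose 2) * ((-1) ^ k *
      (of_nat (Suc N + k) * 1 - of_nat (N - k) * 1)))"
  proof (rule fps_agree_sum, rule fps_agree_X_power_mult)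
    fix k assume "k \<in> {..N}"
    then have k: "k \<le> N" by simp
    have "fps_agree (N - k) (eta_fps 1 * qbin (?X ^ 1) ((Suc N + k) + (N - k)) (Suc N + k)) 1"
      "fps_agree (N - k) (eta_fps 1 * qbin (?X ^ 1) ((N - k) + (Suc N + k)) (N - k)) 1"
      by (intro eta_mult_qbin_agree; simp)+
    moreover have "(Suc N + k) + (N - k) = ?n" "(N - k) + (Suc N + k) = ?n" using k by auto
    ultimately show "fps_agree (N - k)
        ((-1) ^ k * (of_nat (Suc N + k) * (eta_fps 1 * qbin ?X ?n (Suc N + k))
          - of_nat (N - k) * (eta_fps 1 * qbin ?X ?n (N - k))))
        ((-1) ^ k * (of_nat (Suc N + k) * 1 - of_nat (N - k) * 1))"
      by (intro fps_agree_mult fps_agree_diff fps_agree_refl) (simp_all only: power_one_right)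
    have "k \<le> Suc k choose 2" by (simp add: choose_two_Suc)
    then show "N \<le> (Suc k choose 2) + (N - k)" by simp
  qed
  also have "\<dots> = (\<Sum>k\<le>N. fps_const ((-1) ^ k * int (2 * k + 1)) * ?X ^ (Suc k choose 2))"
  proof (rule sum.cong)
    fix k assume "k \<in> {..N}"
    then have "of_nat (Suc N + k) * 1 - of_nat (N - k) * 1 = (of_nat (2 * k + 1) :: int fps)"
      by (simp add: of_nat_diff)
    moreover have c: "fps_const ((-1) ^ k * int (2 * k + 1)) = (-1) ^ k * of_nat (2 * k + 1)"
      by (simp only: fps_const_mult[symmetric] fps_const_power[symmetric] fps_const_neg[symmetric]
          fps_const_1_eq_1 fps_of_nat)
    ultimately show "?X ^ (Suc k choose 2) * ((-1) ^ k * (of_nat (Suc N + k) * 1 - of_nat (N - k) * 1))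
        = fps_const ((-1) ^ k * int (2 * k + 1)) * ?X ^ (Suc k choose 2)"
      by (simp only: c) (simp only: mult_ac)
  qed simp
  also have "fps_agree N \<dots> jacobi_theta"
    unfolding jacobi_theta_def
    by (rule fps_agree_sum_X_power) (auto simp: choose_two_Suc)
  finally show "fps_agree N (eta_fps 1 ^ 3) jacobi_theta"
    by (simp add: eval_nat_numeral mult_ac)
qed

section \<open>Dissection modulo five\<close>

text \<open>
  Selecting the exponents of a fixed residue modulo \<open>m\<close> is linear over power series in \<open>X\<^sup>m\<close>.
\<close>
lemma fps_nth_mult_compose_X_power:
  fixes a b :: "'a::idom fps"
  assumes "r < m"
  shows "fps_nth (a * (b oo fps_X ^ m)) (m * n + r) = fps_nth (Abs_fps (\<lambda>n. fps_nth a (m * n + r)) * b) n"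
proof -
  have m: "m > 0" using assms by simp
  have "fps_nth ((b oo fps_X ^ m) * a) (m * n + r)
      = (\<Sum>i\<in>{i. i \<le> m * n + r \<and> m dvd i}. fps_nth b (i div m) * fps_nth a (m * n + r - i))"
    unfolding fps_mult_nth fps_nth_compose_X_power
    by (intro sum.mono_neutral_cong_right) auto
  also have "\<dots> = (\<Sum>j\<in>{0..n}. fps_nth b j * fps_nth a (m * (n - j) + r))"
  proof (rule sum.reindex_bij_witness[of _ "\<lambda>j. m * j" "\<lambda>i. i div m"])
    fix i assume "i \<in> {i. i \<le> m * n + r \<and> m dvd i}"
    then obtain j where j: "i = m * j" "m * j \<le> m * n + r" by auto
    have "m * j < m * Suc n" using j(2) assms by simp
    then have "j \<le> n" by (simp only: mult_less_cancel1 less_Suc_eq_le)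
    then show "m * (i div m) = i" "i div m \<in> {0..n}"
      "fps_nth b (i div m) * fps_nth a (m * (n - i div m) + r) = fps_nth b (i div m) * fps_nth a (m * n + r - i)"
      using j m by (auto simp: diff_mult_distrib2)
  qed (use m in \<open>auto intro: trans_le_add1\<close>)
  finally show ?thesis
    by (simp add: mult.commute[of a] mult.commute[of "Abs_fps _"] fps_mult_nth)
qed

lemma eta_fps_compose:
  assumes "k > 0" "m > 0"
  shows "eta_fps k oo fps_X ^ m = eta_fps (m * k)"
proof (rule fps_ext)
  fix n
  have 0: "fps_nth (fps_X ^ m :: int fps) 0 = 0" using assms by simp
  have "(\<Prod>i\<le>n. 1 - fps_X ^ (m * k * Suc i)) = (\<Prod>i\<le>n. 1 - fps_X ^ (k * Suc i)) oo (fps_X ^ m :: int fps)"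
    by (simp add: fps_compose_prod_distrib[OF 0] fps_compose_sub_distrib fps_compose_power[OF 0, symmetric]
        fps_X_fps_compose_startby0[OF 0] power_mult[symmetric] mult_ac del: power_Suc mult_Suc mult_Suc_right)
  then have "fps_nth (eta_fps (m * k)) n = fps_nth ((\<Prod>i\<le>n. 1 - fps_X ^ (k * Suc i)) oo fps_X ^ m) n"
    using eta_fps_nth[of "m * k" n] assms by simp
  also have "\<dots> = fps_nth (eta_fps k oo fps_X ^ m) n"
    unfolding fps_nth_compose_X_power eta_fps_nth[OF assms(1)]
    using eta_partial_prod_nth_stable[OF assms(1), of "n div m" n "n div m"] by simp
  finally show "fps_nth (eta_fps k oo fps_X ^ m) n = fps_nth (eta_fps (m * k)) n" ..
qed

lemma square_mod_5: "(m::int)\<^sup>2 mod 5 \<in> {0, 1, 4}" "m\<^sup>2 mod 5 = 0 \<longleftrightarrow> 5 dvd m"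
proof -
  have "0 \<le> m mod 5" "m mod 5 < 5" by simp_all
  then consider "m mod 5 = 0" | "m mod 5 = 1" | "m mod 5 = 2" | "m mod 5 = 3" | "m mod 5 = 4"
    by linarith
  moreover have "m\<^sup>2 mod 5 = (m mod 5)\<^sup>2 mod 5" by (simp add: power_mod)
  ultimately show "m\<^sup>2 mod 5 \<in> {0, 1, 4}" "m\<^sup>2 mod 5 = 0 \<longleftrightarrow> 5 dvd m"
    by (cases; simp add: dvd_eq_mod_eq_0)+
qed

lemma gauss_theta_support:
  assumes "fps_nth gauss_theta n \<noteq> 0"
  shows "n mod 5 \<in> {0, 1, 4}"
proof -
  have "{m. m\<^sup>2 = int n} \<noteq> {}" using assms unfolding gauss_theta_def by (metis fps_nth_Abs_fps sum.empty)
  then obtain m where "m\<^sup>2 = int n" by blast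
  then have "int (n mod 5) \<in> {0, 1, 4}" using square_mod_5(1)[of m] by (simp add: zmod_int)
  then show ?thesis by auto
qed

text \<open>
  If 5 divides a square, then it divides its root, so the part of the series with exponents divisible
  by 5 comes from the roots \<open>5m\<close>; their parity is that of \<open>m\<close>.
\<close>
lemma gauss_theta_nth_5:
  "fps_nth gauss_theta (5 * n) = fps_nth (gauss_theta oo fps_X ^ 5) n"
proof (cases "5 dvd n")
  case True
  then obtain l where l: "n = 5 * l" by auto
  have "(\<Sum>m | m\<^sup>2 = int (25 * l). (-1) ^ nat \<bar>m\<bar> :: int) = (\<Sum>m | m\<^sup>2 = int l. (-1) ^ nat \<bar>m\<bar>)"
  proof (rule sum.reindex_bij_witness[of _ "\<lambda>m. 5 * m" "\<lambda>m. m div 5"])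
    fix m :: int assume "m \<in> {m. m\<^sup>2 = int (25 * l)}"
    then have m: "m\<^sup>2 = 25 * int l" by simp
    then have "m\<^sup>2 mod 5 = 0" by simp
    then obtain k where k: "m = 5 * k" using square_mod_5(2) by auto
    then show "5 * (m div 5) = m" "m div 5 \<in> {m. m\<^sup>2 = int l}"
      "(-1) ^ nat \<bar>m div 5\<bar> = ((-1) ^ nat \<bar>m\<bar> :: int)"
      using m by (auto simp: power2_eq_square abs_mult nat_mult_distrib power_mult)
  qed (auto simp: power2_eq_square)
  then show ?thesis by (simp add: l fps_nth_compose_X_power gauss_theta_def)
next
  case False
  have "{m. m\<^sup>2 = int (5 * n)} = {}"
  proof (rule ccontr)
    assume "{m. m\<^sup>2 = int (5 * n)} \<noteq> {}"
    then obtain m where m: "m\<^sup>2 = 5 * int n" by auto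
    then have "m\<^sup>2 mod 5 = 0" by simp
    then obtain k where "m = 5 * k" using square_mod_5(2) by auto
    then have "int n = 5 * k\<^sup>2" using m by (simp add: power2_eq_square)
    then show False using False by presburger
  qed
  then show ?thesis using False by (simp only: gauss_theta_def) (simp add: fps_nth_compose_X_power)
qed

text \<open>
  Completing the square makes residues of triangular numbers a matter of squares.
\<close>
lemma triangular_eq_iff: "Suc k choose 2 = n \<longleftrightarrow> (2 * int k + 1)\<^sup>2 = 8 * int n + 1"
proof -
  have "Suc k choose 2 = n \<longleftrightarrow> 2 * int (Suc k choose 2) = 2 * int n" by simp
  also have "\<dots> \<longleftrightarrow> (2 * int k + 1)\<^sup>2 = 8 * int n + 1"
    unfolding int_choose_two by (auto simp: power2_eq_square algebra_simps)
  finally show ?thesis .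
qed

lemma jacobi_theta_support:
  assumes "fps_nth jacobi_theta n \<noteq> 0"
  shows "n mod 5 \<in> {0, 1, 3}"
proof -
  have "{k. Suc k choose 2 = n} \<noteq> {}" using assms unfolding jacobi_theta_def by (metis fps_nth_Abs_fps sum.empty)
  then obtain k where "(2 * int k + 1)\<^sup>2 = 8 * int n + 1" by (auto simp: triangular_eq_iff)
  then have "(8 * int n + 1) mod 5 \<in> {0, 1, 4}" using square_mod_5(1)[of "2 * int k + 1"] by metis
  then show ?thesis by (simp only: insert_iff empty_iff) presburger
qed

text \<open>
  A triangular number \<open>k(k+1)/2\<close> is congruent to 3 modulo 5 exactly if 5 divides \<open>2k + 1\<close>, that is
  \<open>k = 5j + 2\<close>. Then \<open>2k + 1 = 5 (2j + 1)\<close>, which is the origin of the factor 5, and \<open>k\<close> and \<open>j\<close> have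
  the same parity.
\<close>
lemma jacobi_theta_nth_3:
  "fps_nth jacobi_theta (5 * n + 3) = 5 * fps_nth (jacobi_theta oo fps_X ^ 5) n"
proof -
  have dvd: "k mod 5 = 2" if "Suc k choose 2 = 5 * n + 3" for k
  proof -
    have "(2 * int k + 1)\<^sup>2 = 5 * (8 * int n + 5)" using that by (simp add: triangular_eq_iff)
    then have "(2 * int k + 1)\<^sup>2 mod 5 = 0" by simp
    then have "5 dvd 2 * int k + 1" by (rule iffD1[OF square_mod_5(2)])
    then show ?thesis by presburger
  qed
  show ?thesis
  proof (cases "5 dvd n")
    case True
    then obtain l where l: "n = 5 * l" by auto
    have "(\<Sum>k | Suc k choose 2 = 25 * l + 3. (-1) ^ k * int (2 * k + 1))
        = (\<Sum>k | Suc k choose 2 = l. 5 * ((-1) ^ k * int (2 * k + 1)))"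
    proof (rule sum.reindex_bij_witness[of _ "\<lambda>k. 5 * k + 2" "\<lambda>k. k div 5"])
      fix k assume "k \<in> {k. Suc k choose 2 = 25 * l + 3}"
      then have k: "Suc k choose 2 = 25 * l + 3" by simp
      then have "k mod 5 = 2" using dvd[of k] l by simp
      then obtain j where j: "k = 5 * j + 2" by (metis mult_div_mod_eq)
      have "(2 * int k + 1)\<^sup>2 = 25 * (8 * int l + 1)" using k by (simp add: triangular_eq_iff)
      then have "(2 * int j + 1)\<^sup>2 = 8 * int l + 1" by (simp add: j power2_eq_square algebra_simps)
      moreover have "k div 5 = j" using j by simp
      ultimately show "5 * (k div 5) + 2 = k" "k div 5 \<in> {k. Suc k choose 2 = l}"
        "5 * ((-1) ^ (k div 5) * int (2 * (k div 5) + 1)) = (-1) ^ k * int (2 * k + 1)"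
        by (simp_all add: triangular_eq_iff power_add power_mult) (simp_all add: j power_add power_mult)
    next
      fix k assume "k \<in> {k. Suc k choose 2 = l}"
      then show "5 * k + 2 \<in> {k. Suc k choose 2 = 25 * l + 3}"
        by (simp add: triangular_eq_iff power2_eq_square algebra_simps)
    qed simp
    then show ?thesis
      by (simp add: l fps_nth_compose_X_power jacobi_theta_def sum_distrib_left)
  next
    case False
    have "{k. Suc k choose 2 = 5 * n + 3} = {}"
    proof (rule ccontr)
      assume "{k. Suc k choose 2 = 5 * n + 3} \<noteq> {}"
      then obtain k where k: "Suc k choose 2 = 5 * n + 3" by auto
      then obtain j where "k = 5 * j + 2" using dvd by (metis mult_div_mod_eq)
      then have "5 * (2 * int j + 1)\<^sup>2 = 8 * int n + 5"
        using k by (simp add: triangular_eq_iff power2_eq_square algebra_simps)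
      then show False using False by presburger
    qed
    then show ?thesis using False by (simp only: jacobi_theta_def) (simp add: fps_nth_compose_X_power)
  qed
qed

text \<open>
  Among the residues 0, 1, 3 of the exponents of the first series and 0, 1, 4 of the second, only the
  pair 3, 0 adds up to 3 modulo 5.
\<close>
lemma theta_product_dissection:
  "Abs_fps (\<lambda>n. fps_nth (jacobi_theta * gauss_theta) (5 * n + 3))
    = 5 * ((jacobi_theta * gauss_theta) oo fps_X ^ 5)"
proof (rule fps_ext)
  fix n
  let ?J = "fps_nth jacobi_theta" and ?G = "fps_nth gauss_theta"
  have "fps_nth (jacobi_theta * gauss_theta) (5 * n + 3)
      = (\<Sum>i\<in>{i. i \<le> 5 * n + 3 \<and> i mod 5 = 3}. ?J i * ?G (5 * n + 3 - i))"
    unfolding fps_mult_nth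
  proof (rule sum.mono_neutral_right)
    show "\<forall>i\<in>{0..5 * n + 3} - {i. i \<le> 5 * n + 3 \<and> i mod 5 = 3}. ?J i * ?G (5 * n + 3 - i) = 0"
    proof
      fix i assume i: "i \<in> {0..5 * n + 3} - {i. i \<le> 5 * n + 3 \<and> i mod 5 = 3}"
      show "?J i * ?G (5 * n + 3 - i) = 0"
      proof (rule ccontr)
        assume "?J i * ?G (5 * n + 3 - i) \<noteq> 0"
        then have "i mod 5 \<in> {0, 1, 3}" "(5 * n + 3 - i) mod 5 \<in> {0, 1, 4}"
          using jacobi_theta_support gauss_theta_support by auto
        moreover have "(i mod 5 + (5 * n + 3 - i) mod 5) mod 5 = 3"
        proof -
          have "i + (5 * n + 3 - i) = 3 + 5 * n" using i by simp
          then have "(i + (5 * n + 3 - i)) mod 5 = 3" by (simp only: mod_mult_self2) simp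
          then show ?thesis by (simp only: mod_add_eq)
        qed
        moreover have "i mod 5 \<noteq> 3" using i by auto
        ultimately show False by auto
      qed
    qed
  qed auto
  also have "\<dots> = (\<Sum>j\<in>{0..n}. ?J (5 * j + 3) * ?G (5 * (n - j)))"
  proof (rule sum.reindex_bij_witness[of _ "\<lambda>j. 5 * j + 3" "\<lambda>i. i div 5"])
    fix i assume i: "i \<in> {i. i \<le> 5 * n + 3 \<and> i mod 5 = 3}"
    then obtain j where j: "i = 5 * j + 3" by (metis (mono_tags) mem_Collect_eq mult_div_mod_eq)
    then have "5 * n + 3 - i = 5 * (n - j)" by simp
    then show "5 * (i div 5) + 3 = i" "i div 5 \<in> {0..n}"
      "?J (5 * (i div 5) + 3) * ?G (5 * (n - i div 5)) = ?J i * ?G (5 * n + 3 - i)"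
      using i j by auto
  qed auto
  also have "\<dots> = 5 * fps_nth ((jacobi_theta oo fps_X ^ 5) * (gauss_theta oo fps_X ^ 5)) n"
    unfolding fps_mult_nth jacobi_theta_nth_3 gauss_theta_nth_5 by (simp add: sum_distrib_left mult_ac)
  finally show "fps_nth (Abs_fps (\<lambda>n. fps_nth (jacobi_theta * gauss_theta) (5 * n + 3))) n
      = fps_nth (5 * ((jacobi_theta * gauss_theta) oo fps_X ^ 5)) n"
    by (simp add: fps_compose_mult_distrib numeral_fps_const)
qed

theorem theorem4:
  shows "Abs_fps (\<lambda>n. T_star (5 * n + 3)) = 5 * Abs_fps M_seq"
proof -
  define T M where "T = Abs_fps T_star" and "M = Abs_fps M_seq"
  have eta_nonzero: "eta_fps k \<noteq> 0" if "k > 0" for k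
    using eta_fps_nth_0[OF that] by auto
  have o_mult: "(a * b) oo fps_X ^ 5 = (a oo fps_X ^ 5) * (b oo (fps_X ^ 5 :: int fps))" for a b
    by (rule fps_compose_mult_distrib) simp
  have o_power: "(a ^ k) oo fps_X ^ 5 = (a oo (fps_X ^ 5 :: int fps)) ^ k" for a k
    by (rule fps_compose_power[symmetric]) simp
  have o_eta: "eta_fps k oo fps_X ^ 5 = eta_fps (5 * k)" if "k > 0" for k
    using that by (intro eta_fps_compose) auto
  have T_eq: "T = eta_fps 1 ^ 5 * eta_fps 10 ^ 5 * fps_right_inverse (eta_fps 2 * eta_fps 5) 1"
    by (rule fps_ext) (simp add: T_def T_star_def)
  have M_eq: "M = eta_fps 2 ^ 5 * eta_fps 5 ^ 5 * fps_right_inverse (eta_fps 1 * eta_fps 10) 1"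
    by (rule fps_ext) (simp add: M_def M_seq_def)
  have "T * (eta_fps 2 * eta_fps 5) = eta_fps 1 ^ 5 * eta_fps 10 ^ 5"
    using eta_fps_mult_inverse[of 2 5] unfolding T_eq by (simp add: mult_ac)
  also have "eta_fps 1 ^ 5 = eta_fps 1 ^ 3 * eta_fps 1 ^ 2"
    by (simp flip: power_add)
  also have "\<dots> = jacobi_theta * (eta_fps 2 * gauss_theta)"
    by (simp only: jacobi gauss)
  finally have "eta_fps 2 * (T * eta_fps 5) = eta_fps 2 * (jacobi_theta * gauss_theta * eta_fps 10 ^ 5)"
    by (simp only: mult_ac)
  then have "T * eta_fps 5 = jacobi_theta * gauss_theta * eta_fps 10 ^ 5"
    using eta_nonzero[of 2] by simp
  then have T: "T * (eta_fps 1 oo fps_X ^ 5) = jacobi_theta * gauss_theta * (eta_fps 2 ^ 5 oo fps_X ^ 5)"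
    by (simp add: o_eta o_power)
  \<comment> \<open>Comparing the coefficients of exponents \<open>5n + 3\<close> on both sides of \<open>T\<close>.\<close>
  have "Abs_fps (\<lambda>n. T_star (5 * n + 3)) * eta_fps 1 = 5 * ((jacobi_theta * gauss_theta) oo fps_X ^ 5) * eta_fps 2 ^ 5"
  proof (rule fps_ext)
    fix n
    have "fps_nth (Abs_fps (\<lambda>n. T_star (5 * n + 3)) * eta_fps 1) n
        = fps_nth (T * (eta_fps 1 oo fps_X ^ 5)) (5 * n + 3)"
      by (subst fps_nth_mult_compose_X_power) (simp_all add: T_def)
    also have "\<dots> = fps_nth (5 * ((jacobi_theta * gauss_theta) oo fps_X ^ 5) * eta_fps 2 ^ 5) n"
      unfolding T by (subst fps_nth_mult_compose_X_power) (simp_all add: theta_product_dissection)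
    finally show "fps_nth (Abs_fps (\<lambda>n. T_star (5 * n + 3)) * eta_fps 1) n
        = fps_nth (5 * ((jacobi_theta * gauss_theta) oo fps_X ^ 5) * eta_fps 2 ^ 5) n" .
  qed
  then have "Abs_fps (\<lambda>n. T_star (5 * n + 3)) * (eta_fps 1 * eta_fps 10)
      = 5 * (jacobi_theta oo fps_X ^ 5) * (eta_fps 10 * (gauss_theta oo fps_X ^ 5)) * eta_fps 2 ^ 5"
    by (simp add: o_mult mult_ac)
  also have "jacobi_theta oo fps_X ^ 5 = eta_fps 5 ^ 3"
    using o_eta[of 1] unfolding jacobi[symmetric] o_power by simp
  also have "eta_fps 10 * (gauss_theta oo fps_X ^ 5) = eta_fps 5 ^ 2"
    using o_eta[of 1] o_eta[of 2] arg_cong[OF gauss, of "\<lambda>a. a oo fps_X ^ 5"]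
    by (simp add: o_mult o_power)
  also have "5 * eta_fps 5 ^ 3 * eta_fps 5 ^ 2 * eta_fps 2 ^ 5 = 5 * (eta_fps 2 ^ 5 * eta_fps 5 ^ 5)"
    by (simp add: mult_ac flip: power_add)
  also have "\<dots> = 5 * M * (eta_fps 1 * eta_fps 10)"
    using eta_fps_mult_inverse[of 1 10] unfolding M_eq by (simp add: mult_ac)
  finally show ?thesis
    using eta_nonzero[of 1] eta_nonzero[of 10] unfolding M_def by simp
qed

end
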